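(* For every input of $2n$ points in general position in the plane (with arbitrary positive weights), the online algorithm with advice Split-and-Match (\textsc{Sam}), given the advice string $D$ produced by the \textsc{Sam} oracle, outputs a perfect non-crossing matching; moreover, the set of all advice strings $D$ that the oracle can produce for inputs of $2n$ points has size (at most) $C_n$, the $n$-th Catalan number.
   Context: Online non-crossing matching: points $p_1,\dots,p_{2n}$ in general position in the plane arrive online; upon arrival a point is irrevocably left unmatched or matched with an earlier unmatched point, keeping the segments of matched pairs pairwise non-crossing. In the advice model, an oracle that knows the whole input writes information that the online algorithm can read. Procedure underlying \textsc{Sam} (run identically by the oracle, who knows the whole input, and by the algorithm): a partition of the plane into convex regions is maintained, initially the whole plane; each region has at most one responsible point. When $p_i$ arrives in region $R$: if $R$ has no responsible point, $p_i$ becomes responsible for $R$ and is left unmatched, and $D[i]=0$. Otherwise let $p_j$ be responsible for $R$; its responsibility is removed and $R$ is divided into two sub-regions $R_1,R_2$ by the line $\overline{p_ip_j}$. The oracle sets $D[i]=1$ if the total number of input points (including future ones, excluding $p_i,p_j$) that lie in $R_1$ is even and likewise for $R_2$, and $D[i]=0$ otherwise. If $D[i]=1$, the algorithm matches $p_i$ with $p_j$ and no point is responsible for $R_1$ or $R_2$; if $D[i]=0$, $p_i$ is left unmatched, $p_j$ becomes responsible for $R_1$ and $p_i$ for $R_2$. (In particular $D[1]=0$.) The oracle writes on the advice tape the binary string $D$ of length $2n$ (encoded as its index in a pre-agreed ordering of the possible strings), which the algorithm decodes before points arrive. *)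

theory Defs
  imports "HOL-Analysis.Analysis"
begin

type_synonym point = "real ^ 2"

definition general_position :: "point list \<Rightarrow> bool" where
  "general_position ps \<longleftrightarrow> distinct ps \<and>
     (\<forall>a\<in>set ps. \<forall>b\<in>set ps. \<forall>c\<in>set ps.
        a \<noteq> b \<longrightarrow> a \<noteq> c \<longrightarrow> b \<noteq> c \<longrightarrow> \<not> collinear {a, b, c})"

text \<open>An input is the list of weighted points in their order of arrival.\<close>

definition valid_input :: "nat \<Rightarrow> (point \<times> real) list \<Rightarrow> bool" where
  "valid_input n I \<longleftrightarrow> length I = 2 * n \<and> general_position (map fst I) \<and>
     (\<forall>w\<in>set (map snd I). w > 0)"

text \<open>A matched pair is the two-element set of its points, so its segment is the convex hull.
  Segments are closed: two matched pairs may not even touch.\<close>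

definition perfect_matching :: "point set \<Rightarrow> point set set \<Rightarrow> bool" where
  "perfect_matching P M \<longleftrightarrow> (\<forall>e\<in>M. e \<subseteq> P \<and> card e = 2) \<and> (\<forall>p\<in>P. \<exists>!e. e \<in> M \<and> p \<in> e)"

definition non_crossing :: "point set set \<Rightarrow> bool" where
  "non_crossing M \<longleftrightarrow> (\<forall>e\<in>M. \<forall>f\<in>M. e \<noteq> f \<longrightarrow> convex hull e \<inter> convex hull f = {})"

text \<open>Regions are kept open: a dividing line belongs to neither of the two sub-regions.
  The regions thus partition the plane minus the cuts made so far. In general
  position no point arrives on such a line, and a point lying on the line that created a
  region is not counted as lying in that region.\<close>

definition left_side :: "point \<Rightarrow> point \<Rightarrow> point set" where
  "left_side q p = {x. (p$1 - q$1) * (x$2 - q$2) - (p$2 - q$2) * (x$1 - q$1) > 0}"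

definition right_side :: "point \<Rightarrow> point \<Rightarrow> point set" where
  "right_side q p = {x. (p$1 - q$1) * (x$2 - q$2) - (p$2 - q$2) * (x$1 - q$1) < 0}"

text \<open>Which of the two sub-regions is called the first one is a convention that both parties
  agree on beforehand. It is a parameter: \<open>lab R q p\<close> says whether the sub-region to the left
  of the line directed from \<open>q\<close> to \<open>p\<close> comes first.\<close>

type_synonym labelling = "point set \<Rightarrow> point \<Rightarrow> point \<Rightarrow> bool"

definition subregions :: "labelling \<Rightarrow> point set \<Rightarrow> point \<Rightarrow> point \<Rightarrow> point set \<times> point set" where
  "subregions lab R q p =
     (if lab R q p then (R \<inter> left_side q p, R \<inter> right_side q p)
      else (R \<inter> right_side q p, R \<inter> left_side q p))"

text \<open>A state consists of the regions, each with its responsible point (if any), and the pairs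
  matched so far.\<close>

type_synonym cell = "point set \<times> point option"
type_synonym state = "cell set \<times> point set set"

definition initial_state :: state where
  "initial_state = ({(UNIV, None)}, {})"

definition cell_of :: "cell set \<Rightarrow> point \<Rightarrow> cell" where
  "cell_of S p = (THE c. c \<in> S \<and> p \<in> fst c)"

definition arrive :: "labelling \<Rightarrow> bool \<Rightarrow> point \<Rightarrow> state \<Rightarrow> state" where
  "arrive lab d p = (\<lambda>(S, M).
     case cell_of S p of
       (R, None) \<Rightarrow> (insert (R, Some p) (S - {(R, None)}), M)
     | (R, Some q) \<Rightarrow>
         (case subregions lab R q p of (R1, R2) \<Rightarrow>
            if d then (insert (R1, None) (insert (R2, None) (S - {(R, Some q)})), insert {q, p} M)
            else (insert (R1, Some q) (insert (R2, Some p) (S - {(R, Some q)})), M)))"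

text \<open>\<open>P\<close> is the set of all input points, including the future ones.\<close>

definition advice_bit :: "labelling \<Rightarrow> point set \<Rightarrow> state \<Rightarrow> point \<Rightarrow> bool" where
  "advice_bit lab P st p =
     (case cell_of (fst st) p of
        (R, None) \<Rightarrow> False
      | (R, Some q) \<Rightarrow>
          (case subregions lab R q p of (R1, R2) \<Rightarrow>
             even (card (P \<inter> R1 - {p, q})) \<and> even (card (P \<inter> R2 - {p, q}))))"

fun advice_from :: "labelling \<Rightarrow> point set \<Rightarrow> state \<Rightarrow> point list \<Rightarrow> bool list" where
  "advice_from lab P st [] = []"
| "advice_from lab P st (p # ps) =
     (let d = advice_bit lab P st p in d # advice_from lab P (arrive lab d p st) ps)"

definition sam_advice :: "labelling \<Rightarrow> point list \<Rightarrow> bool list" where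
  "sam_advice lab ps = advice_from lab (set ps) initial_state ps"

definition sam :: "labelling \<Rightarrow> bool list \<Rightarrow> point list \<Rightarrow> point set set" where
  "sam lab D ps = snd (fold (\<lambda>(d, p). arrive lab d p) (zip D ps) initial_state)"

lemma length_advice_from: "length (advice_from lab P st ps) = length ps"
  by (induction ps arbitrary: st) (simp_all add: Let_def)

lemma length_sam_advice [simp]: "length (sam_advice lab ps) = length ps"
  by (simp add: sam_advice_def length_advice_from)

definition advice_strings :: "labelling \<Rightarrow> nat \<Rightarrow> bool list set" where
  "advice_strings lab n = {sam_advice lab (map fst I) | I. valid_input n I}"

definition catalan :: "nat \<Rightarrow> nat" where
  "catalan n = ((2 * n) choose n) div (n + 1)"

lemma catalan_exact: "(n + 1) * catalan n = (2 * n) choose n"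
proof (cases n)
  case 0
  then show ?thesis by (simp add: catalan_def)
next
  case (Suc m)
  have "Suc n * ((2 * n) choose Suc n) = n * ((2 * n) choose n)"
    using binomial_absorption[of n "2 * n"] binomial_absorb_comp[of "2 * n" n] Suc by simp
  then have "(n + 1) dvd n * ((2 * n) choose n)"
    by (metis Suc_eq_plus1 dvd_triv_left)
  moreover have "coprime (n + 1) n"
    by simp
  ultimately have "(n + 1) dvd ((2 * n) choose n)"
    using coprime_dvd_mult_right_iff by blast
  then show ?thesis
    unfolding catalan_def by (rule dvd_mult_div_cancel)
qed

end

theory Submission
  imports Defs
begin

text \<open>
  Call a region even or odd according to the number of its points still to come. Since no three
  points are collinear, a cut through two points loses no further point, so the oracle's rule keeps
  every region without responsible point even and every region with a responsible point odd.
  At the end no point is still to come, hence no point is responsible, and every point that is not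
  responsible has been matched. A new segment runs inside an open convex region, apart from one
  endpoint that may lie on the boundary, while the earlier segments avoid all regions.

  The ones of an advice string correspond to the matched pairs, so among the first \<open>k\<close> bits at
  most \<open>k / 2\<close> are ones, with equality for \<open>k = 2 n\<close>: the string is a Dyck word.
\<close>

section \<open>Sides of a line\<close>

text \<open>The cross product is affine in \<open>x\<close>; in this form the library facts on
  convexity, openness and closure of open half-spaces apply.\<close>

lemma left_side_halfspace:
  "left_side q p = {x. vector [q$2 - p$2, p$1 - q$1] \<bullet> x > (p$1 - q$1) * q$2 - (p$2 - q$2) * q$1}"
  by (auto simp: left_side_def inner_vec_def sum_2 algebra_simps)

lemma right_side_eq_left_side: "right_side q p = left_side p q"
  by (auto simp: left_side_def right_side_def algebra_simps)

lemma convex_left_side: "convex (left_side q p)"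
  unfolding left_side_halfspace by (rule convex_halfspace_gt)

lemma open_left_side: "open (left_side q p)"
  unfolding left_side_halfspace by (rule open_halfspace_gt)

lemma left_side_disjoint: "left_side q p \<inter> left_side p q = {}"
  by (auto simp: left_side_def algebra_simps)

text \<open>With a nonzero normal vector, the closure of an open half-plane is the closed one, which
  contains the dividing line.\<close>

lemma closure_left_side:
  assumes "p \<noteq> q"
  shows "p \<in> closure (left_side q p)" "q \<in> closure (left_side q p)"
proof -
  have nz: "vector [q$2 - p$2, p$1 - q$1] \<noteq> (0 :: real^2)"
    using assms by (auto simp: vec_eq_iff forall_2)
  show "p \<in> closure (left_side q p)" "q \<in> closure (left_side q p)"
    unfolding left_side_halfspace closure_halfspace_gt[OF nz]
    by (auto simp: inner_vec_def sum_2 algebra_simps)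
qed

text \<open>The complement is a closed half-plane, hence convex, and its boundary line contains both
  points.\<close>

lemma convex_hull_left_side_disjoint: "convex hull {q, p} \<inter> left_side q p = {}"
proof -
  have eq: "- left_side q p
      = {x. vector [q$2 - p$2, p$1 - q$1] \<bullet> x \<le> (p$1 - q$1) * q$2 - (p$2 - q$2) * q$1}"
    unfolding left_side_halfspace by auto
  have "convex (- left_side q p)"
    unfolding eq by (rule convex_halfspace_le)
  moreover have "{q, p} \<subseteq> - left_side q p"
    by (auto simp: left_side_def)
  ultimately have "convex hull {q, p} \<subseteq> - left_side q p"
    by (intro hull_minimal)
  then show ?thesis by blast
qed

text \<open>Off both open sides the cross product vanishes, so \<open>x - q\<close> is a multiple of
  \<open>p - q\<close>; the factor is read off from a coordinate in which \<open>p\<close> and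
  \<open>q\<close> differ.\<close>

lemma not_collinear_imp_side:
  assumes "\<not> collinear {q, p, x}"
  shows "x \<in> left_side q p \<union> left_side p q"
proof (rule ccontr)
  assume "x \<notin> left_side q p \<union> left_side p q"
  then have cross: "(p$1 - q$1) * (x$2 - q$2) = (p$2 - q$2) * (x$1 - q$1)"
    by (auto simp: left_side_def algebra_simps)
  have "p \<noteq> q"
    using assms by auto
  have "collinear {0, p - q, x - q}"
  proof (cases "p$1 = q$1")
    case True
    with \<open>p \<noteq> q\<close> have "p$2 \<noteq> q$2"
      by (auto simp: vec_eq_iff forall_2)
    moreover from this True cross have "x$1 = q$1"
      by simp
    ultimately have "x - q = ((x$2 - q$2) / (p$2 - q$2)) *\<^sub>R (p - q)"
      using True by (simp add: vec_eq_iff forall_2)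
    then show ?thesis
      by (metis collinear_lemma)
  next
    case False
    with cross have "x - q = ((x$1 - q$1) / (p$1 - q$1)) *\<^sub>R (p - q)"
      by (simp add: vec_eq_iff forall_2 nonzero_eq_divide_eq mult.commute)
    then show ?thesis
      by (metis collinear_lemma)
  qed
  then have "collinear {p, q, x}"
    by (subst collinear_3) simp
  with assms show False
    by (simp add: insert_commute)
qed

text \<open>A responsible point may lie on the boundary of its cell, so membership in the closure is
  what has to survive repeated cuts.\<close>

lemma closure_Int_left_side:
  assumes R: "open R" "convex R" and "p \<in> R" "q \<in> closure R" "p \<noteq> q"
  shows "p \<in> closure (R \<inter> left_side q p)" "q \<in> closure (R \<inter> left_side q p)"
    "p \<in> closure (R \<inter> left_side p q)" "q \<in> closure (R \<inter> left_side p q)"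
proof -
  have *: "closure (R \<inter> H) = closure R \<inter> closure H"
    if "open H" "convex H" "p \<in> closure H" for H
  proof -
    \<comment> \<open>\<open>p\<close> lies in the open set \<open>R\<close> and in the closure of
      \<open>H\<close>, so \<open>R\<close> meets \<open>H\<close>; for open convex sets that meet,
      closure commutes with intersection.\<close>
    have "R \<inter> H \<noteq> {}"
      using open_Int_closure_eq_empty[of R H] assms that by auto
    then show ?thesis
      using R that by (intro closure_Int_convex) (auto simp: rel_interior_open)
  qed
  have "p \<in> closure R"
    using \<open>p \<in> R\<close> closure_subset by blast
  moreover note \<open>q \<in> closure R\<close> closure_left_side[OF \<open>p \<noteq> q\<close>] closure_left_side[OF \<open>p \<noteq> q\<close>[symmetric]]
  ultimately show "p \<in> closure (R \<inter> left_side q p)" "q \<in> closure (R \<inter> left_side q p)"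
    "p \<in> closure (R \<inter> left_side p q)" "q \<in> closure (R \<inter> left_side p q)"
    by (simp_all add: * open_left_side convex_left_side)
qed

text \<open>The closure facts follow the rule for an unmatched arrival: \<open>q\<close> takes over
  \<open>R1\<close> and \<open>p\<close> takes over \<open>R2\<close>.\<close>

lemma subregions_properties:
  assumes sub: "subregions lab R q p = (R1, R2)"
    and R: "open R" "convex R" "p \<in> R" "q \<in> closure R" "p \<noteq> q"
  shows "open R1" "convex R1" "open R2" "convex R2" "R1 \<subseteq> R" "R2 \<subseteq> R" "R1 \<inter> R2 = {}"
    "q \<in> closure R1" "p \<in> closure R2"
    "convex hull {q, p} \<inter> R1 = {}" "convex hull {q, p} \<inter> R2 = {}"
    "\<And>x. x \<in> R \<Longrightarrow> \<not> collinear {q, p, x} \<Longrightarrow> x \<in> R1 \<union> R2"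
proof -
  have "R1 = R \<inter> left_side q p \<and> R2 = R \<inter> left_side p q \<or>
      R1 = R \<inter> left_side p q \<and> R2 = R \<inter> left_side q p"
    using sub by (simp add: subregions_def right_side_eq_left_side split: if_splits)
  \<comment> \<open>Leaving the order of the two half-planes open treats both values of the
    labelling at once.\<close>
  then obtain H H' where H: "R1 = R \<inter> H" "R2 = R \<inter> H'"
    "H = left_side q p \<and> H' = left_side p q \<or> H = left_side p q \<and> H' = left_side q p"
    by blast
  show "open R1" "convex R1" "open R2" "convex R2"
    using H open_left_side convex_left_side R(1,2) by (metis convex_Int open_Int)+
  show "R1 \<subseteq> R" "R2 \<subseteq> R"
    using H(1,2) by simp_all
  show "R1 \<inter> R2 = {}"
    using H left_side_disjoint[of q p] by blast
  show "q \<in> closure R1" "p \<in> closure R2"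
    using H closure_Int_left_side[OF R] by metis+
  have "convex hull {q, p} \<inter> left_side p q = {}"
    using convex_hull_left_side_disjoint[of p q] by (simp add: insert_commute)
  then show "convex hull {q, p} \<inter> R1 = {}" "convex hull {q, p} \<inter> R2 = {}"
    using H convex_hull_left_side_disjoint[of q p] by blast+
  show "x \<in> R1 \<union> R2" if "x \<in> R" "\<not> collinear {q, p, x}" for x
    using not_collinear_imp_side[OF that(2)] that(1) H by blast
qed

section \<open>The invariant\<close>

text \<open>\<open>F\<close> is the set of points that are still to arrive.\<close>

locale sam_state =
  fixes P F :: "point set" and S :: "cell set" and M :: "point set set"
  assumes finite_P: "finite P"
    and not_collinear: "\<And>a b c. a \<in> P \<Longrightarrow> b \<in> P \<Longrightarrow> c \<in> P \<Longrightarrow> a \<noteq> b \<Longrightarrow> a \<noteq> c \<Longrightarrow> b \<noteq> c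
      \<Longrightarrow> \<not> collinear {a, b, c}"
    and F_subset: "F \<subseteq> P"
    and cell_open: "\<And>c. c \<in> S \<Longrightarrow> open (fst c)"
    and cell_convex: "\<And>c. c \<in> S \<Longrightarrow> convex (fst c)"
    and cell_disjoint: "\<And>c d. c \<in> S \<Longrightarrow> d \<in> S \<Longrightarrow> c \<noteq> d \<Longrightarrow> fst c \<inter> fst d = {}"
    and F_covered: "\<And>x. x \<in> F \<Longrightarrow> \<exists>c\<in>S. x \<in> fst c"
    and cell_points: "\<And>c. c \<in> S \<Longrightarrow> P \<inter> fst c \<subseteq> F \<union> set_option (snd c)"
    and cell_parity: "\<And>c. c \<in> S \<Longrightarrow> even (card (F \<inter> fst c)) \<longleftrightarrow> snd c = None"
    and resp: "\<And>R q. (R, Some q) \<in> S \<Longrightarrow> q \<in> P - F - \<Union>M \<and> q \<in> closure R"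
    and resp_unique: "\<And>R R' q. (R, Some q) \<in> S \<Longrightarrow> (R', Some q) \<in> S \<Longrightarrow> R = R'"
    and matched: "\<And>e. e \<in> M \<Longrightarrow> e \<subseteq> P - F \<and> card e = 2"
    and non_crossing: "non_crossing M"
    and hull_cell_disjoint: "\<And>e c. e \<in> M \<Longrightarrow> c \<in> S \<Longrightarrow> convex hull e \<inter> fst c = {}"
    and arrived: "\<And>x. x \<in> P - F \<Longrightarrow> x \<in> \<Union>M \<or> (\<exists>R. (R, Some x) \<in> S)"
begin

section \<open>Counting consequences of the invariant\<close>

lemma finite_M: "finite M"
proof (rule finite_subset)
  show "M \<subseteq> Pow P" using matched by blast
qed (simp add: finite_P)

text \<open>Segments are closed, so two pairs with a common point would already cross.\<close>

lemma matched_disjoint: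
  assumes "e \<in> M" "f \<in> M" "e \<noteq> f"
  shows "e \<inter> f = {}"
  using non_crossing assms hull_subset[of e convex] hull_subset[of f convex]
  unfolding non_crossing_def by blast

lemma card_Union_M: "card (\<Union>M) = 2 * card M"
proof -
  have "card (\<Union>M) = (\<Sum>e\<in>M. card e)"
    using matched matched_disjoint
    by (intro card_Union_disjoint)
      (auto simp: pairwise_def disjnt_def intro: finite_subset[OF _ finite_P])
  also have "\<dots> = 2 * card M"
    using matched by simp
  finally show ?thesis .
qed

text \<open>Applied at every stage of the run, this becomes the prefix condition on the advice
  string.\<close>

lemma card_M_le: "2 * card M \<le> card (P - F)"
proof -
  have "card (\<Union>M) \<le> card (P - F)"
    using matched finite_P by (intro card_mono) auto
  then show ?thesis
    by (simp add: card_Union_M)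
qed

lemma perfect_matching_final:
  assumes "F = {}"
  shows "perfect_matching P M" "2 * card M = card P"
proof -
  have "\<Union>M = P"
  proof
    show "\<Union>M \<subseteq> P" using matched by blast
    show "P \<subseteq> \<Union>M"
    proof
      fix x assume "x \<in> P"
      then have "x \<in> \<Union>M \<or> (\<exists>R. (R, Some x) \<in> S)"
        using arrived[of x] assms by simp
      \<comment> \<open>Without future points every cell has count 0, which is even, and the parity
        clause excludes a responsible point.\<close>
      moreover have "(R, Some x) \<notin> S" for R
        using cell_parity[of "(R, Some x)"] assms by auto
      ultimately show "x \<in> \<Union>M" by blast
    qed
  qed
  then show "perfect_matching P M" "2 * card M = card P"
    using matched matched_disjoint card_Union_M unfolding perfect_matching_def by auto blast+
qed

lemma cell_of_eq:
  assumes "c \<in> S" "p \<in> fst c"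
  shows "cell_of S p = c"
  unfolding cell_of_def
proof (rule the_equality)
  show "d = c" if "d \<in> S \<and> p \<in> fst d" for d
    using cell_disjoint[of c d] assms that by auto
qed (use assms in simp)

text \<open>The arrival lowers the count of future points by one in this cell only, since cells are
  disjoint; the parity flip matches the new responsibility.\<close>

lemma step_none:
  assumes p: "p \<in> F" "(R, None) \<in> S" "p \<in> R"
  shows "sam_state P (F - {p}) (insert (R, Some p) (S - {(R, None)})) M"
proof
  let ?S = "S - {(R, None)}"
  have notin: "p \<notin> fst c" if "c \<in> ?S" for c
    using cell_disjoint[of c "(R, None)"] that p by auto
  have R: "c \<in> S \<Longrightarrow> c \<noteq> (R, None) \<Longrightarrow> R \<inter> fst c = {}" for c
    using cell_disjoint[of c "(R, None)"] p by auto
  have other: "(R', Some q) \<in> S \<Longrightarrow> q \<noteq> p" for R' q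
    using resp p by blast
  show "finite P" by (fact finite_P)
  show "\<not> collinear {a, b, c}" if "a \<in> P" "b \<in> P" "c \<in> P" "a \<noteq> b" "a \<noteq> c" "b \<noteq> c" for a b c
    using that by (rule not_collinear)
  show "F - {p} \<subseteq> P" using F_subset by blast
  show "open (fst c)" "convex (fst c)" if "c \<in> insert (R, Some p) ?S" for c
    using that cell_open[of c] cell_convex[of c] cell_open[OF p(2)] cell_convex[OF p(2)] by auto
  show "fst c \<inter> fst d = {}"
    if "c \<in> insert (R, Some p) ?S" "d \<in> insert (R, Some p) ?S" "c \<noteq> d" for c d
    using that cell_disjoint[of c d] R[of c] R[of d] by auto
  show "\<exists>c\<in>insert (R, Some p) ?S. x \<in> fst c" if "x \<in> F - {p}" for x
    using F_covered[of x] that by auto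
  show "P \<inter> fst c \<subseteq> F - {p} \<union> set_option (snd c)" if "c \<in> insert (R, Some p) ?S" for c
    using that cell_points[of c] cell_points[OF p(2)] notin[of c] by auto
  show "even (card ((F - {p}) \<inter> fst c)) \<longleftrightarrow> snd c = None" if "c \<in> insert (R, Some p) ?S" for c
  proof (cases "c \<in> ?S")
    case True
    then have "(F - {p}) \<inter> fst c = F \<inter> fst c"
      using notin[of c] by auto
    then show ?thesis
      using cell_parity[of c] True by simp
  next
    case False
    with that have c: "c = (R, Some p)" by blast
    have "F \<inter> R = insert p ((F - {p}) \<inter> R)"
      using p by auto
    moreover have "finite F"
      using F_subset finite_P finite_subset by blast
    ultimately have "card (F \<inter> R) = Suc (card ((F - {p}) \<inter> R))"
      by simp
    then show ?thesis
      using cell_parity[OF p(2)] c by simp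
  qed
  show "q \<in> P - (F - {p}) - \<Union>M \<and> q \<in> closure R'"
    if "(R', Some q) \<in> insert (R, Some p) ?S" for R' q
  proof (cases "(R', Some q) \<in> ?S")
    case True
    then show ?thesis using resp by blast
  next
    case False
    then show ?thesis
      using that p F_subset matched closure_subset[of R] by blast
  qed
  show "R' = R''"
    if "(R', Some q) \<in> insert (R, Some p) ?S" "(R'', Some q) \<in> insert (R, Some p) ?S" for R' R'' q
    using that resp_unique[of R' q R''] other[of R' q] other[of R'' q] by auto
  show "e \<subseteq> P - (F - {p}) \<and> card e = 2" if "e \<in> M" for e
    using matched[OF that] by blast
  show "non_crossing M" by (fact non_crossing)
  show "convex hull e \<inter> fst c = {}" if "e \<in> M" "c \<in> insert (R, Some p) ?S" for e c
    using that hull_cell_disjoint[of e c] hull_cell_disjoint[OF that(1) p(2)] by auto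
  show "x \<in> \<Union>M \<or> (\<exists>R'. (R', Some x) \<in> insert (R, Some p) ?S)" if "x \<in> P - (F - {p})" for x
    using that arrived[of x] by blast
qed

section \<open>Splitting a cell along the line through \<open>q\<close> and \<open>p\<close>\<close>

context
  fixes p R q lab R1 R2
  assumes p: "p \<in> F" and cell: "(R, Some q) \<in> S" and pR: "p \<in> R"
    and sub: "subregions lab R q p = (R1, R2)"
begin

lemma p_neq_q: "p \<noteq> q"
  using p resp[OF cell] by blast

lemmas sub_props = subregions_properties[OF sub cell_open[OF cell, simplified]
    cell_convex[OF cell, simplified] pR conjunct2[OF resp[OF cell]] p_neq_q]

lemma split_notin: "p \<notin> R1" "p \<notin> R2" "q \<notin> R1" "q \<notin> R2"
  using sub_props(10,11) hull_subset[of "{q, p}" convex] by auto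

text \<open>A future point lost on the cut would be collinear with \<open>q\<close> and
  \<open>p\<close>.\<close>

lemma split_future: "(F - {p}) \<inter> R = ((F - {p}) \<inter> R1) \<union> ((F - {p}) \<inter> R2)"
proof -
  have "x \<in> R1 \<union> R2" if "x \<in> F - {p}" "x \<in> R" for x
    using that F_subset p resp[OF cell] p_neq_q by (intro sub_props(12) not_collinear) auto
  then show ?thesis
    using sub_props(5,6) by blast
qed

text \<open>This links the oracle's count over all input points to the invariant's count of future
  points: by \<open>cell_points\<close>, the only arrived input point that \<open>R\<close> could
  contain before this step is \<open>q\<close>.\<close>

lemma split_points: "P \<inter> R1 - {p, q} = (F - {p}) \<inter> R1" "P \<inter> R2 - {p, q} = (F - {p}) \<inter> R2"
  using cell_points[OF cell] sub_props(5,6) F_subset split_notin by auto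

text \<open>The cell has an odd count because \<open>q\<close> is responsible; removing
  \<open>p\<close> leaves an even total. Hence one piece alone decides the advice bit.\<close>

lemma split_parity: "even (card ((F - {p}) \<inter> R1)) \<longleftrightarrow> even (card ((F - {p}) \<inter> R2))"
proof -
  have fin: "finite F"
    using F_subset finite_P finite_subset by blast
  have "F \<inter> R = insert p ((F - {p}) \<inter> R)"
    using p pR by auto
  then have "card (F \<inter> R) = Suc (card ((F - {p}) \<inter> R))"
    using fin by simp
  moreover have "card ((F - {p}) \<inter> R) = card ((F - {p}) \<inter> R1) + card ((F - {p}) \<inter> R2)"
    unfolding split_future using fin sub_props(7) by (intro card_Un_disjoint) auto
  ultimately show ?thesis
    using cell_parity[OF cell] by auto
qed

text \<open>In a convex set, the open segment from an interior point to a point of the closure stays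
  in the interior.\<close>

lemma hull_subset_insert: "convex hull {q, p} \<subseteq> insert q R"
proof
  fix x assume "x \<in> convex hull {q, p}"
  then have x: "x \<in> closed_segment q p"
    by (simp add: segment_convex_hull)
  have "open_segment p q \<subseteq> interior R"
    using cell_convex[OF cell] resp[OF cell] pR cell_open[OF cell]
    by (intro in_interior_closure_convex_segment) (auto simp: interior_open)
  with x pR show "x \<in> insert q R"
    using interior_subset by (auto simp: open_segment_def closed_segment_commute)
qed

lemma other_cell:
  assumes "c \<in> S - {(R, Some q)}"
  shows "R \<inter> fst c = {}" "q \<notin> fst c" "snd c \<noteq> Some q" "snd c \<noteq> Some p"
    "(F - {p}) \<inter> fst c = F \<inter> fst c"
proof -
  show R: "R \<inter> fst c = {}"
    using cell_disjoint[OF cell, of c] assms by auto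
  show q: "snd c \<noteq> Some q"
    using resp_unique[OF cell, of "fst c"] assms by (cases c) auto
  \<comment> \<open>Disjointness from \<open>R\<close> does not suffice, as \<open>q\<close> may lie
    outside \<open>R\<close>; instead, an arrived input point inside a cell must be responsible for
    it.\<close>
  show "q \<notin> fst c"
    using q cell_points[of c] resp[OF cell] assms by auto
  show "snd c \<noteq> Some p"
    using resp[of "fst c" p] p assms by (cases c) auto
  show "(F - {p}) \<inter> fst c = F \<inter> fst c"
    using R pR by auto
qed

text \<open>Inside \<open>R\<close> the invariant keeps old segments away. The remaining point
  \<open>q\<close> is unmatched, so on an old segment it would be collinear with the two
  endpoints.\<close>

lemma hull_disjoint_matched:
  assumes "e \<in> M"
  shows "convex hull {q, p} \<inter> convex hull e = {}"
proof -
  have "q \<notin> convex hull e"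
  proof
    assume q: "q \<in> convex hull e"
    obtain a b where e: "e = {a, b}" "a \<noteq> b"
      using matched[OF assms] by (auto simp: card_2_iff)
    then have "q \<in> closed_segment a b"
      using q by (simp add: segment_convex_hull)
    then have "collinear {a, b, q}"
      by (metis between_mem_segment between_imp_collinear insert_commute)
    moreover have "a \<in> P" "b \<in> P" "q \<in> P" "q \<noteq> a" "q \<noteq> b"
      using e matched[OF assms] resp[OF cell] assms by auto
    ultimately show False
      using not_collinear[of a b q] e by auto
  qed
  then show ?thesis
    using hull_subset_insert hull_cell_disjoint[OF assms cell] by auto
qed

text \<open>Both outcomes of the advice bit are checked together, since the geometric clauses do not
  depend on the choice between them.\<close>

lemma step_some_aux:
  assumes S': "S' = insert (R1, r1) (insert (R2, r2) (S - {(R, Some q)}))"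
    and cases: "even (card ((F - {p}) \<inter> R1)) \<and> r1 = None \<and> r2 = None \<and> M' = insert {q, p} M \<or>
      odd (card ((F - {p}) \<inter> R1)) \<and> r1 = Some q \<and> r2 = Some p \<and> M' = M"
  shows "sam_state P (F - {p}) S' M'"
proof
  have S'_cases: "c = (R1, r1) \<or> c = (R2, r2) \<or> c \<in> S - {(R, Some q)}" if "c \<in> S'" for c
    using that S' by auto
  have R12: "R1 \<inter> fst c = {}" "R2 \<inter> fst c = {}" if "c \<in> S - {(R, Some q)}" for c
    using other_cell(1)[OF that] sub_props(5,6) by auto
  have par: "even (card ((F - {p}) \<inter> R1)) \<longleftrightarrow> r1 = None"
    "even (card ((F - {p}) \<inter> R2)) \<longleftrightarrow> r2 = None"
    using cases split_parity by auto
  have M'_cases: "e = {q, p} \<or> e \<in> M" if "e \<in> M'" for e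
    using that cases by auto
  show "finite P" by (fact finite_P)
  show "\<not> collinear {a, b, c}" if "a \<in> P" "b \<in> P" "c \<in> P" "a \<noteq> b" "a \<noteq> c" "b \<noteq> c" for a b c
    using that by (rule not_collinear)
  show "F - {p} \<subseteq> P" using F_subset by blast
  show "open (fst c)" if "c \<in> S'" for c
    using S'_cases[OF that] sub_props(1,3) cell_open[of c] by auto
  show "convex (fst c)" if "c \<in> S'" for c
    using S'_cases[OF that] sub_props(2,4) cell_convex[of c] by auto
  show "fst c \<inter> fst d = {}" if "c \<in> S'" "d \<in> S'" "c \<noteq> d" for c d
    using S'_cases[OF that(1)] S'_cases[OF that(2)] that(3) R12[of c] R12[of d] sub_props(7)
      cell_disjoint[of c d]
    by (elim disjE) auto
  show "\<exists>c\<in>S'. x \<in> fst c" if x: "x \<in> F - {p}" for x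
  proof (cases "x \<in> R")
    case True
    then have "x \<in> R1 \<or> x \<in> R2"
      using x split_future by blast
    then show ?thesis
      unfolding S' by auto
  next
    case False
    obtain c where "c \<in> S" "x \<in> fst c"
      using F_covered x by blast
    with False show ?thesis
      unfolding S' by auto
  qed
  show "P \<inter> fst c \<subseteq> F - {p} \<union> set_option (snd c)" if "c \<in> S'" for c
    using S'_cases[OF that]
  proof (elim disjE)
    assume c: "c \<in> S - {(R, Some q)}"
    then show ?thesis
      using cell_points[of c] other_cell(1)[OF c] pR by auto
  qed (use split_points split_notin in auto)
  show "even (card ((F - {p}) \<inter> fst c)) \<longleftrightarrow> snd c = None" if "c \<in> S'" for c
    using S'_cases[OF that]
  proof (elim disjE)
    assume c: "c \<in> S - {(R, Some q)}"
    then show ?thesis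
      using cell_parity[of c] other_cell(5)[OF c] by simp
  qed (simp_all add: par)
  show "x \<in> P - (F - {p}) - \<Union>M' \<and> x \<in> closure R'" if "(R', Some x) \<in> S'" for R' x
    using S'_cases[OF that]
  proof (elim disjE)
    assume c: "(R', Some x) \<in> S - {(R, Some q)}"
    then have "x \<in> P - F - \<Union>M \<and> x \<in> closure R'"
      using resp by blast
    then show ?thesis
      using other_cell(3,4)[OF c] by (auto dest!: M'_cases)
  next
    assume "(R', Some x) = (R1, r1)"
    then show ?thesis
      using cases resp[OF cell] sub_props(8) by auto
  next
    assume "(R', Some x) = (R2, r2)"
    then show ?thesis
      using cases p F_subset matched sub_props(9) by auto
  qed
  show "R' = R''" if "(R', Some x) \<in> S'" "(R'', Some x) \<in> S'" for R' R'' x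
    using S'_cases[OF that(1)] S'_cases[OF that(2)] resp_unique[of R' x R''] cases p_neq_q
      other_cell(3,4)[of "(R', Some x)"] other_cell(3,4)[of "(R'', Some x)"]
    by (elim disjE) simp_all
  show "e \<subseteq> P - (F - {p}) \<and> card e = 2" if "e \<in> M'" for e
    using M'_cases[OF that] matched[of e] p_neq_q p F_subset resp[OF cell] by auto
  show "non_crossing M'"
    unfolding non_crossing_def
  proof (intro ballI impI)
    fix e f assume ef: "e \<in> M'" "f \<in> M'" "e \<noteq> f"
    show "convex hull e \<inter> convex hull f = {}"
      using M'_cases[OF ef(1)] M'_cases[OF ef(2)] ef(3) non_crossing
        hull_disjoint_matched[of e] hull_disjoint_matched[of f]
      unfolding non_crossing_def by (elim disjE) (simp_all add: Int_commute)
  qed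
  show "convex hull e \<inter> fst c = {}" if "e \<in> M'" "c \<in> S'" for e c
    using M'_cases[OF that(1)]
  proof
    assume e: "e = {q, p}"
    \<comment> \<open>The new segment avoids both pieces; apart from \<open>q\<close> it lies in
      \<open>R\<close>, which misses the other cells, and \<open>q\<close> lies in none of
      these.\<close>
    show ?thesis
      using S'_cases[OF that(2)] sub_props(10,11) e hull_subset_insert other_cell(1,2)[of c]
      by (elim disjE) auto
  next
    assume "e \<in> M"
    then show ?thesis
      using S'_cases[OF that(2)] hull_cell_disjoint[of e c] hull_cell_disjoint[OF _ cell, of e]
        sub_props(5,6) by (elim disjE) auto
  qed
  show "x \<in> \<Union>M' \<or> (\<exists>R'. (R', Some x) \<in> S')" if "x \<in> P - (F - {p})" for x
  proof (cases "x = p \<or> x = q")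
    case True
    then show ?thesis
      using cases unfolding S' by blast
  next
    case False
    then have "x \<in> P - F"
      using that by blast
    then consider "x \<in> \<Union>M" | R' where "(R', Some x) \<in> S"
      using arrived[of x] by blast
    then show ?thesis
    proof cases
      case 1
      then show ?thesis using cases by blast
    next
      case 2
      then show ?thesis using False unfolding S' by blast
    qed
  qed
qed

end

text \<open>The cardinality claim is what later identifies the ones of the advice string with the
  matched pairs.\<close>

lemma step:
  assumes p: "p \<in> F" and d: "d = advice_bit lab P (S, M) p" and st: "arrive lab d p (S, M) = (S', M')"
  shows "sam_state P (F - {p}) S' M'" "card M' = card M + (if d then 1 else 0)"
proof -
  obtain R r where c: "(R, r) \<in> S" "p \<in> R"
    using F_covered[OF p] by force
  then have cell: "cell_of S p = (R, r)"
    by (intro cell_of_eq) auto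
  have "sam_state P (F - {p}) S' M' \<and> card M' = card M + (if d then 1 else 0)"
  proof (cases r)
    case None
    then show ?thesis
      using c cell d st step_none[OF p] by (auto simp: arrive_def advice_bit_def)
  next
    case (Some q)
    obtain R1 R2 where sub: "subregions lab R q p = (R1, R2)"
      by fastforce
    note facts = p c(1)[unfolded Some] c(2) sub
    have d': "d \<longleftrightarrow> even (card ((F - {p}) \<inter> R1))"
      using d cell Some sub split_points[OF facts] split_parity[OF facts]
      by (simp add: advice_bit_def)
    \<comment> \<open>Pairs in \<open>M\<close> contain no future point, so inserting this one
      really enlarges \<open>M\<close>.\<close>
    have "{q, p} \<notin> M"
      using matched p by blast
    then show ?thesis
      using st cell Some sub d' finite_M step_some_aux[OF facts refl]
      by (auto simp: arrive_def split: if_splits)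
  qed
  then show "sam_state P (F - {p}) S' M'" "card M' = card M + (if d then 1 else 0)"
    by auto
qed

end

section \<open>The run of the algorithm\<close>

text \<open>The start state is arbitrary so that the induction can run along the remaining points.
  The prefix bound compares two points per pair with the number of arrived points after
  \<open>k\<close> further steps.\<close>

lemma sam_run:
  assumes "sam_state P (set ps) S M" "distinct ps"
    and "D = advice_from lab P (S, M) ps"
    and "fold (\<lambda>(d, p). arrive lab d p) (zip D ps) (S, M) = (S', M')"
  shows "sam_state P {} S' M' \<and> card M' = card M + count_list D True \<and>
    (\<forall>k\<le>length ps. 2 * (card M + count_list (take k D) True) \<le> card (P - set ps) + k)"
  using assms
proof (induction ps arbitrary: S M D)
  case Nil
  interpret sam_state P "set []" S M by fact
  show ?case
    using Nil card_M_le by simp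
next
  case (Cons p ps)
  interpret sam_state P "set (p # ps)" S M by fact
  define d where "d = advice_bit lab P (S, M) p"
  obtain S1 M1 where st: "arrive lab d p (S, M) = (S1, M1)"
    by fastforce
  define D1 where "D1 = advice_from lab P (S1, M1) ps"
  have D: "D = d # D1"
    using Cons.prems(3) st by (simp add: d_def D1_def Let_def)
  have F: "set (p # ps) - {p} = set ps"
    using Cons.prems(2) by auto
  have step1: "sam_state P (set ps) S1 M1" "card M1 = card M + (if d then 1 else 0)"
    using step[OF _ d_def st] unfolding F by auto
  have IH: "sam_state P {} S' M'" "card M' = card M1 + count_list D1 True"
    "\<And>k. k \<le> length ps \<Longrightarrow> 2 * (card M1 + count_list (take k D1) True) \<le> card (P - set ps) + k"
    using Cons.IH[OF step1(1) _ D1_def] Cons.prems(2,4) D st by auto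
  have "P - set (p # ps) = (P - set ps) - {p}"
    by auto
  moreover have "p \<in> P - set ps"
    using F_subset Cons.prems(2) by auto
  ultimately have card: "card (P - set ps) = Suc (card (P - set (p # ps)))"
    using finite_P by (simp only:) (intro card.remove, auto)
  have "2 * (card M + count_list (take k D) True) \<le> card (P - set (p # ps)) + k"
    if "k \<le> length (p # ps)" for k
  \<comment> \<open>\<open>k = 0\<close> is the bound for the present state; for
    \<open>Suc j\<close>, the first bit is absorbed into \<open>card M1\<close> and \<open>p\<close>
    is counted as arrived.\<close>
  proof (cases k)
    case 0
    then show ?thesis using card_M_le by simp
  next
    case (Suc j)
    then show ?thesis
      using IH(3)[of j] that step1(2) card D by (auto split: if_splits)
  qed
  then show ?case
    using IH(1,2) step1(2) D by auto
qed

text \<open>Evenness of the input length is the parity clause for the whole plane, which starts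
  without a responsible point.\<close>

lemma sam_state_initial:
  assumes "general_position ps" "even (length ps)"
  shows "sam_state (set ps) (set ps) {(UNIV, None)} {}"
  using assms
  by unfold_locales (auto simp: general_position_def non_crossing_def distinct_card)

lemma sam_correct:
  fixes lab :: labelling
  assumes "general_position ps" "even (length ps)"
  defines "D \<equiv> sam_advice lab ps"
  shows "perfect_matching (set ps) (sam lab D ps)" "non_crossing (sam lab D ps)"
    "2 * count_list D True = length ps"
    "\<And>k. k \<le> length ps \<Longrightarrow> 2 * count_list (take k D) True \<le> k"
proof -
  have ps: "distinct ps"
    using assms by (simp add: general_position_def)
  obtain S' M' where fold: "fold (\<lambda>(d, p). arrive lab d p) (zip D ps) ({(UNIV, None)}, {}) = (S', M')"
    by fastforce
  have D: "D = advice_from lab (set ps) ({(UNIV, None)}, {}) ps"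
    by (simp add: D_def sam_advice_def initial_state_def)
  have run: "sam_state (set ps) {} S' M'" "card M' = count_list D True"
    "\<And>k. k \<le> length ps \<Longrightarrow> 2 * count_list (take k D) True \<le> k"
    using sam_run[OF sam_state_initial[OF assms(1,2)] ps D fold] by auto
  have M': "sam lab D ps = M'"
    using fold by (simp add: sam_def initial_state_def)
  show "perfect_matching (set ps) (sam lab D ps)" "2 * count_list D True = length ps"
    using sam_state.perfect_matching_final[OF run(1)] run(2) M' distinct_card[OF ps] by auto
  show "non_crossing (sam lab D ps)"
    using sam_state.non_crossing[OF run(1)] M' by simp
  show "2 * count_list (take k D) True \<le> k" if "k \<le> length ps" for k
    using run(3) that .
qed

section \<open>Ballot words\<close>

text \<open>These are ballot sequences in which \<open>True\<close> never leads, Dyck words if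
  \<open>a = b\<close>; a prefix of length \<open>k\<close> satisfies this iff at most half of its
  letters are \<open>True\<close>.\<close>

definition ballot_words :: "nat \<Rightarrow> nat \<Rightarrow> bool list set" where
  "ballot_words a b = {w. count_list w False = a \<and> count_list w True = b \<and>
     (\<forall>k\<le>length w. 2 * count_list (take k w) True \<le> k)}"

lemma length_bool_list: "length w = count_list w False + count_list w True"
  by (induction w) auto

lemma finite_ballot_words: "finite (ballot_words a b)"
proof (rule finite_subset)
  show "ballot_words a b \<subseteq> {w. set w \<subseteq> UNIV \<and> length w = a + b}"
    by (auto simp: ballot_words_def length_bool_list)
qed (rule finite_lists_length_eq, simp)

lemma ballot_words_empty:
  assumes "a < b"
  shows "ballot_words a b = {}"
proof -
  have False if "w \<in> ballot_words a b" for w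
  proof -
    \<comment> \<open>This is the prefix condition for the whole word.\<close>
    have "2 * b \<le> a + b"
      using that length_bool_list[of w] by (force simp: ballot_words_def)
    with assms show False by simp
  qed
  then show ?thesis by blast
qed

text \<open>The only new prefix is the whole word, which prepares recursion on the last
  letter.\<close>

lemma ballot_append:
  "(\<forall>k\<le>length (w @ [x]). 2 * count_list (take k (w @ [x])) True \<le> k) \<longleftrightarrow>
   (\<forall>k\<le>length w. 2 * count_list (take k w) True \<le> k) \<and>
   2 * count_list (w @ [x]) True \<le> Suc (length w)"
  by (auto simp: le_Suc_eq)

text \<open>A final \<open>False\<close> cannot violate the bound; a final \<open>True\<close> can,
  whence the condition \<open>b \<le> a\<close>.\<close>

lemma ballot_words_append:
  "w @ [False] \<in> ballot_words a b \<longleftrightarrow> (\<exists>a'. a = Suc a' \<and> w \<in> ballot_words a' b)"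
  "w @ [True] \<in> ballot_words a b \<longleftrightarrow> (\<exists>b'. b = Suc b' \<and> b \<le> a \<and> w \<in> ballot_words a b')"
  unfolding ballot_words_def mem_Collect_eq ballot_append
  by (auto simp: length_bool_list)

lemma ballot_words_zero: "ballot_words a 0 = {replicate a False}"
proof -
  have "w = replicate (length w) False" if "count_list w True = 0" for w
    using that by (induction w) (auto split: if_splits)
  moreover have "count_list (replicate a False) False = a" "count_list (replicate a False) True = 0"
    by (induction a) auto
  ultimately show ?thesis
    unfolding ballot_words_def
    by (auto simp: length_bool_list)
qed

text \<open>Classifying words by their last letter gives a Pascal-type recurrence; for
  \<open>b = a\<close> the first summand is zero.\<close>

lemma card_ballot_words_Suc:
  assumes "b \<le> a"
  shows "card (ballot_words (Suc a) (Suc b)) = card (ballot_words a (Suc b)) + card (ballot_words (Suc a) b)"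
proof -
  let ?f = "\<lambda>x w. w @ [x :: bool]"
  have "ballot_words (Suc a) (Suc b) = ?f False ` ballot_words a (Suc b) \<union> ?f True ` ballot_words (Suc a) b"
    (is "?L = ?R")
  proof (rule set_eqI)
    fix w
    show "w \<in> ?L \<longleftrightarrow> w \<in> ?R"
    proof (cases w rule: rev_cases)
      case Nil
      then show ?thesis by (auto simp: ballot_words_def)
    next
      case (snoc v x)
      then show ?thesis
        using assms by (cases x) (auto simp: ballot_words_append)
    qed
  qed
  then have "card ?L = card (?f False ` ballot_words a (Suc b)) + card (?f True ` ballot_words (Suc a) b)"
    by (simp only:) (rule card_Un_disjoint, auto simp: finite_ballot_words)
  then show ?thesis
    by (simp add: card_image inj_on_def)
qed

text \<open>The case \<open>b = a + 1\<close>, where both binomial coefficients agree, is what starts the induction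
  at the boundary.\<close>

lemma card_ballot_words:
  "b \<le> Suc a \<Longrightarrow> card (ballot_words a b) + (a + b choose Suc a) = (a + b choose a)"
proof (induction "a + b" arbitrary: a b rule: less_induct)
  case less
  show ?case
  proof (cases b)
    case 0
    then show ?thesis by (simp add: ballot_words_zero)
  next
    case (Suc b')
    show ?thesis
    proof (cases "b = Suc a")
      case True
      then show ?thesis
        using binomial_symmetric[of a "a + b"] by (simp add: ballot_words_empty)
    next
      case False
      with less.prems Suc obtain a' where a: "a = Suc a'" "b' \<le> a'"
        by (cases a) auto
      have "card (ballot_words a' b) + (a' + b choose Suc a') = (a' + b choose a')"
        using less.hyps[of a' b] a Suc by simp
      moreover have "card (ballot_words a b') + (a + b' choose Suc a) = (a + b' choose a)"
        using less.hyps[of a b'] a Suc by simp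
      \<comment> \<open>Both binomial coefficients obey Pascal's rule, so the two instances add up
        to the claim.\<close>
      ultimately show ?thesis
        using card_ballot_words_Suc[OF a(2)] a Suc by simp
    qed
  qed
qed

text \<open>The count is \<open>(2 * n choose n)\<close> minus \<open>(2 * n choose Suc n)\<close>;
  multiplied by \<open>Suc n\<close>, the subtracted term becomes
  \<open>n * (2 * n choose n)\<close>, leaving one copy of the central coefficient.\<close>

lemma card_ballot_words_catalan: "card (ballot_words n n) = catalan n"
proof -
  have "Suc n * (2 * n choose Suc n) = n * (2 * n choose n)"
  proof (cases n)
    case (Suc m)
    then show ?thesis
      using binomial_absorption[of n "2 * n"] binomial_absorb_comp[of "2 * n" n] by simp
  qed simp
  moreover have "Suc n * (card (ballot_words n n) + (2 * n choose Suc n)) = Suc n * (2 * n choose n)"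
    using card_ballot_words[of n n] by (simp add: mult_2)
  ultimately have "Suc n * card (ballot_words n n) = (2 * n choose n)"
    by (simp add: distrib_left)
  then have "Suc n * card (ballot_words n n) = Suc n * catalan n"
    using catalan_exact[of n] by simp
  then show ?thesis
    by (simp only: mult_cancel1) simp
qed

text \<open>Half of the \<open>2 * n\<close> bits are ones, so the zeros also number
  \<open>n\<close>; the prefix bound completes the Dyck condition.\<close>

lemma advice_strings_subset: "advice_strings lab n \<subseteq> ballot_words n n"
proof
  fix D assume "D \<in> advice_strings lab n"
  then obtain ps where D: "D = sam_advice lab ps" and ps: "general_position ps" "length ps = 2 * n"
    by (auto simp: advice_strings_def valid_input_def)
  then show "D \<in> ballot_words n n"
    using sam_correct(3,4)[of ps, where lab = lab] length_bool_list[of D] by (auto simp: ballot_words_def)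
qed

theorem theorem16:
  fixes n :: nat and lab :: labelling
  shows "(\<forall>I. valid_input n I \<longrightarrow>
            (let ps = map fst I; M = sam lab (sam_advice lab ps) ps
             in perfect_matching (set ps) M \<and> non_crossing M)) \<and>
         finite (advice_strings lab n) \<and> card (advice_strings lab n) \<le> catalan n"
proof (intro conjI)
  show "\<forall>I. valid_input n I \<longrightarrow>
            (let ps = map fst I; M = sam lab (sam_advice lab ps) ps
             in perfect_matching (set ps) M \<and> non_crossing M)"
    unfolding Let_def by (intro allI impI conjI sam_correct) (simp_all add: valid_input_def)
  show "finite (advice_strings lab n)"
    using advice_strings_subset finite_ballot_words finite_subset by blast
  show "card (advice_strings lab n) \<le> catalan n"
    using card_mono[OF finite_ballot_words advice_strings_subset]
    by (simp add: card_ballot_words_catalan)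
qed

end
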